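(* Let $p=3$, $1\le m\le n-1$, and let $I=[m]_2\cup B$ be a saturated generalized order ideal of $\mathbb{GH}(m,n)$ in which every element of $[m]$ has multiplicity $2$ and $B$ has nonzero multiplicity vector $v_B\in\{0,1,2\}^{n-m}$ on $[n]\setminus[m]$, so that $I(\mathbb{GP})=(\mathbb{F}_3^m\times0)\cup\big(\{2\}^m\times(\mathrm{box}(v_B)\setminus0)\big)$. Let $D=\mathbb{F}_3^n\setminus I(\mathbb{GP})$, so that $|D|=3^n-3^m-2^{t_1}3^{t_2}+1$, with $t_1,t_2$ referring to $v_B$. For nonzero $u=(v,w)$, $v\in\mathbb{F}_3^m$, $w\in\mathbb{F}_3^{n-m}$, with $\sigma=\sum_{i\le m}v_i\in\mathbb{F}_3$, \[ \mathrm{wt}(c_D(u))=\tfrac13\Big(2|D|+2\cdot3^m[v=0]+3^{t_2}e(w)\,2^{z(w)}(-1)^{o(w)}\phi(\sigma+s_1(w))-\phi(\sigma)\Big). \] The number of nonzero $u$ in the class determined by $[v=0]$, $\sigma$, $e(w)=e$, $z(w)=z$, $s_1(w)=c$ is the product of the number of $v$ in the class (namely $1$ for $v=0$; $3^{m-1}-1$ for $v\ne0$, $\sigma=0$; $3^{m-1}$ for each given value $\sigma\ne0$) and \[ \big([e=1]+(3^{t_2}-1)[e=0]\big)\binom{t_1}{z}N_c(t_1-z)\,3^{n-m-t_1-t_2}, \] less one for the class containing $u=0$.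
   Context: $[n]=\{1,\dots,n\}$; $[\,\cdot\,]$ applied to a condition is $1$ if it holds and $0$ otherwise; $\mathrm{wt}$ is Hamming weight; $c_D(u)=(u\cdot x)_{x\in D}$ with $u\cdot x=\sum_iu_ix_i\in\mathbb{F}_3$. $\mathbb{F}_3$ is identified with $\{0,1,2\}$. Generalized order ideals ($p=3$): $[n]_2$ is the multiset in which each $i\in[n]$ has multiplicity $2$. A sub-multiset $J$ is identified with its multiplicity vector $(J_1,\dots,J_n)\in\{0,1,2\}^n=\mathbb{F}_3^n$; $J\subseteq J'$ means $J_i\le J'_i$ (as integers) for all $i$; $\bar J=\{i:J_i\ne0\}$. The hierarchical poset $\mathbb{H}(m,n)$ on $[n]$ has as its only strict relations $i\prec j$ for all $i\in[m]$, $j\in[n]\setminus[m]$; $\mathbb{GH}(m,n)$ denotes $[n]_2$ together with this order. $J$ is a saturated generalized order ideal if $\bar J$ is a down-closed subset of $\mathbb{H}(m,n)$ and $J_i=2$ whenever $j\in\bar J$ and $i\prec j$. $I(\mathbb{GP})\subseteq\mathbb{F}_3^n$ is the set of all saturated generalized order ideals contained in $I$. Notation attached to $v_B\in\{0,1,2\}^{n-m}$: $T_j=\{i:(v_B)_i=j\}$, $t_j=|T_j|$, $\mathrm{box}(v_B)=\prod_i\{0,\dots,(v_B)_i\}\subseteq\mathbb{F}_3^{n-m}$. For $w\in\mathbb{F}_3^{n-m}$: $z(w)=|\{i\in T_1:w_i=0\}|$, $o(w)=t_1-z(w)$, $s_1(w)=\sum_{i\in T_1}w_i\in\mathbb{F}_3$,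 $e(w)=1$ if $w_i=0$ for all $i\in T_2$ and $e(w)=0$ otherwise. For $c\in\mathbb{F}_3$, $\phi(c)=2[c=0]-[c\ne0]$. For an integer $o\ge0$ and $c\in\mathbb{F}_3$, $N_c(o)$ is the number of vectors in $\{1,2\}^o$ whose coordinate sum is $c$ in $\mathbb{F}_3$, i.e. $N_0(o)=(2^o+2(-1)^o)/3$ and $N_c(o)=(2^o-(-1)^o)/3$ for $c\ne0$. *)

theory Defs
  imports
    Complex_Main
    "HOL-Library.Numeral_Type"
    "HOL-Library.FuncSet"
    "Jordan_Normal_Form.Matrix"
begin

section \<open>The field with three elements\<close>

text \<open>
  The library type 3 is the ring of integers modulo 3.  Its library order compares the
  representatives 0, 1, 2 as integers, so the (componentwise) order on \<open>F3 vec\<close> is exactly the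
  sub-multiset relation on multiplicity vectors.
\<close>

type_synonym F3 = "3"

lemma F3_cases: "(x :: F3) = 0 \<or> x = 1 \<or> x = 2"
proof (cases x)
  case (of_int z)
  then have "z = 0 \<or> z = 1 \<or> z = 2"
    by simp linarith
  then show ?thesis
    using of_int(1) by (elim disjE) simp_all
qed

lemma UNIV_F3: "(UNIV :: F3 set) = {0, 1, 2}"
  using F3_cases by blast

lemma F3_field: "(x :: F3) \<noteq> 0 \<Longrightarrow> \<exists>y. x * y = 1"
proof -
  have "(2 :: F3) * 2 = 1" by simp
  then show "x \<noteq> 0 \<Longrightarrow> \<exists>y. x * y = 1"
    using F3_cases[of x] by (metis mult_1)
qed

lemma F3_order: "(0 :: F3) < 1" "(1 :: F3) < 2"
  by (simp_all add: less_bit1_def bit1.Rep_numeral bit1.Rep_0 bit1.Rep_1)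

definition coord_sum :: "F3 vec \<Rightarrow> F3" where
  "coord_sum x = (\<Sum>i<dim_vec x. x $ i)"


section \<open>Generalized order ideals\<close>

text \<open>
  Coordinates are numbered from 0, as is usual for the library vectors: \<open>[n]\<close> is \<open>{..<n}\<close> and
  \<open>[m]\<close> is \<open>{..<m}\<close>.  A poset on \<open>[n]\<close> is given by its strict relation, and a sub-multiset of
  \<open>[n]\<^sub>2\<close> by its multiplicity vector in \<open>carrier_vec n\<close>.
\<close>

definition hier :: "nat \<Rightarrow> nat \<Rightarrow> nat \<Rightarrow> nat \<Rightarrow> bool" where
  "hier m n i j \<longleftrightarrow> i < m \<and> m \<le> j \<and> j < n"

definition supp :: "F3 vec \<Rightarrow> nat set" where
  "supp J = {i. i < dim_vec J \<and> J $ i \<noteq> 0}"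

definition down_closed :: "(nat \<Rightarrow> nat \<Rightarrow> bool) \<Rightarrow> nat set \<Rightarrow> bool" where
  "down_closed prec A \<longleftrightarrow> (\<forall>j\<in>A. \<forall>i. prec i j \<longrightarrow> i \<in> A)"

definition saturated_ideal :: "(nat \<Rightarrow> nat \<Rightarrow> bool) \<Rightarrow> nat \<Rightarrow> F3 vec \<Rightarrow> bool" where
  "saturated_ideal prec n J \<longleftrightarrow>
     J \<in> carrier_vec n \<and> down_closed prec (supp J) \<and>
     (\<forall>j\<in>supp J. \<forall>i. prec i j \<longrightarrow> J $ i = 2)"

definition ideals_in :: "(nat \<Rightarrow> nat \<Rightarrow> bool) \<Rightarrow> nat \<Rightarrow> F3 vec \<Rightarrow> F3 vec set" where
  "ideals_in prec n I = {J. saturated_ideal prec n J \<and> J \<le> I}"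

definition twos :: "nat \<Rightarrow> F3 vec" where
  "twos k = vec k (\<lambda>_. 2)"


section \<open>Codewords and Hamming weight\<close>

definition codeword :: "F3 vec set \<Rightarrow> F3 vec \<Rightarrow> F3 vec \<Rightarrow> F3" where
  "codeword D u = (\<lambda>x\<in>D. u \<bullet> x)"

definition hamming_wt :: "F3 vec set \<Rightarrow> (F3 vec \<Rightarrow> F3) \<Rightarrow> nat" where
  "hamming_wt D c = card {x \<in> D. c x \<noteq> 0}"


section \<open>Notation attached to the vector $v_B$\<close>

definition Tset :: "F3 vec \<Rightarrow> F3 \<Rightarrow> nat set" where
  "Tset vB j = {i. i < dim_vec vB \<and> vB $ i = j}"

definition box :: "F3 vec \<Rightarrow> F3 vec set" where
  "box vB = {y \<in> carrier_vec (dim_vec vB). \<forall>i<dim_vec vB. y $ i \<in> {0..vB $ i}}"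

definition zcount :: "F3 vec \<Rightarrow> F3 vec \<Rightarrow> nat" where
  "zcount vB w = card {i \<in> Tset vB 1. w $ i = 0}"

definition ocount :: "F3 vec \<Rightarrow> F3 vec \<Rightarrow> nat" where
  "ocount vB w = card (Tset vB 1) - zcount vB w"

definition s1 :: "F3 vec \<Rightarrow> F3 vec \<Rightarrow> F3" where
  "s1 vB w = (\<Sum>i\<in>Tset vB 1. w $ i)"

definition eind :: "F3 vec \<Rightarrow> F3 vec \<Rightarrow> nat" where
  "eind vB w = (if \<forall>i\<in>Tset vB 2. w $ i = 0 then 1 else 0)"

definition phi :: "F3 \<Rightarrow> int" where
  "phi c = 2 * of_bool (c = 0) - of_bool (c \<noteq> 0)"

definition N :: "F3 \<Rightarrow> nat \<Rightarrow> nat" where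
  "N c k = card {x \<in> carrier_vec k. (\<forall>i<k. x $ i \<in> {1, 2}) \<and> coord_sum x = c}"

lemma coord_sum_vCons: "coord_sum (vCons a x) = a + coord_sum x"
  unfolding coord_sum_def dim_vec_vCons sum.lessThan_Suc_shift by simp

lemma finite_N_set: "finite {x \<in> carrier_vec k. (\<forall>i<k. x $ i \<in> {1, 2}) \<and> coord_sum x = c}"
proof -
  have "finite (UNIV :: F3 set)"
    unfolding UNIV_F3 by simp
  then have "finite {xs :: F3 list. set xs \<subseteq> UNIV \<and> length xs = k}"
    by (rule finite_lists_length_eq)
  moreover have "carrier_vec k \<subseteq> vec_of_list ` {xs :: F3 list. set xs \<subseteq> UNIV \<and> length xs = k}"
  proof
    fix x :: "F3 vec" assume "x \<in> carrier_vec k"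
    then show "x \<in> vec_of_list ` {xs :: F3 list. set xs \<subseteq> UNIV \<and> length xs = k}"
      by (intro image_eqI[of _ _ "list_of_vec x"]) (auto simp: vec_list)
  qed
  ultimately have "finite (carrier_vec k :: F3 vec set)"
    by (rule finite_surj)
  then show ?thesis
    by (rule rev_finite_subset) (rule Collect_restrict)
qed

lemma N_Suc: "N c (Suc k) = N (c - 1) k + N (c - 2) k"
proof -
  let ?S = "\<lambda>c k. {x \<in> carrier_vec k. (\<forall>i<k. x $ i \<in> {1, 2 :: F3}) \<and> coord_sum x = c}"
  have "?S c (Suc k) = vCons 1 ` ?S (c - 1) k \<union> vCons 2 ` ?S (c - 2) k" (is "?L = ?R")
  proof
    show "?L \<subseteq> ?R"
    proof
      fix x assume x: "x \<in> ?L"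
      then obtain a y where xy: "x = vCons a y" by (cases x) auto
      have "x $ 0 \<in> {1, 2}" using x by blast
      then have a: "a = 1 \<or> a = 2" using xy by simp
      have y: "y \<in> carrier_vec k" using x xy by simp
      have "y $ i \<in> {1, 2}" if "i < k" for i
      proof -
        have "x $ Suc i \<in> {1, 2}" using x that by blast
        then show ?thesis using xy y that by simp
      qed
      moreover have "coord_sum y = c - a"
        using x xy by (auto simp: coord_sum_vCons)
      ultimately show "x \<in> ?R" using a y xy by blast
    qed
    show "?R \<subseteq> ?L"
      by (auto simp: coord_sum_vCons less_Suc_eq_0_disj)
  qed
  then have "N c (Suc k) = card (vCons 1 ` ?S (c - 1) k \<union> vCons 2 ` ?S (c - 2) k)"
    unfolding N_def by (rule arg_cong)
  also have "\<dots> = card (vCons 1 ` ?S (c - 1) k) + card (vCons 2 ` ?S (c - 2) k)"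
  proof (rule card_Un_disjoint)
    have "vCons 1 ` A \<inter> vCons 2 ` B = {}" for A B :: "F3 vec set"
      by auto
    then show "vCons 1 ` ?S (c - 1) k \<inter> vCons 2 ` ?S (c - 2) k = {}" .
  qed (rule finite_imageI, rule finite_N_set)+
  also have "card (vCons 1 ` ?S (c - 1) k) = N (c - 1) k"
    unfolding N_def by (rule card_image) (simp add: inj_on_def)
  also have "card (vCons 2 ` ?S (c - 2) k) = N (c - 2) k"
    unfolding N_def by (rule card_image) (simp add: inj_on_def)
  finally show ?thesis .
qed

lemma N_closed_form:
  "3 * int (N c k) = (if c = 0 then 2 ^ k + 2 * (- 1) ^ k else 2 ^ k - (- 1) ^ k)"
proof (induction k arbitrary: c)
  case 0
  have "{x \<in> carrier_vec 0. (\<forall>i<0. x $ i \<in> {1, 2}) \<and> coord_sum x = c} = (if c = 0 then {vNil} else {})"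
    by (auto simp: coord_sum_def)
  then show ?case by (simp add: N_def)
next
  case (Suc k)
  consider "c = 0" | "c = 1" | "c = 2" using F3_cases by blast
  then show ?case
    by cases (simp_all add: N_Suc distrib_left Suc.IH)
qed


section \<open>The classes of $u = (v, w)$\<close>

definition vclass :: "nat \<Rightarrow> bool \<Rightarrow> F3 \<Rightarrow> F3 vec set" where
  "vclass m b \<sigma> = {v \<in> carrier_vec m. (v = 0\<^sub>v m \<longleftrightarrow> b) \<and> coord_sum v = \<sigma>}"

definition uclass ::
  "nat \<Rightarrow> F3 vec \<Rightarrow> bool \<Rightarrow> F3 \<Rightarrow> nat \<Rightarrow> nat \<Rightarrow> F3 \<Rightarrow> F3 vec set" where
  "uclass m vB b \<sigma> e z c =
     {v @\<^sub>v w | v w. v \<in> vclass m b \<sigma> \<and> w \<in> carrier_vec (dim_vec vB) \<and>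
        eind vB w = e \<and> zcount vB w = z \<and> s1 vB w = c}"

end

theory Submission
  imports Defs
begin

text \<open>
  With \<open>\<zeta>\<close> a primitive cube root of unity, \<open>phi c = \<zeta>\<^sup>c + \<zeta>\<^sup>-\<^sup>c\<close> is an integer, and
  \<open>2 - phi c\<close> is 3 or 0 according to whether \<open>c\<close> is nonzero.  Hence three times the weight of
  the codeword of \<open>u\<close> is \<open>2 * card D\<close> minus the sum of \<open>phi (u \<bullet> x)\<close> over \<open>D\<close>
  (\<open>hamming_wt_phi_sum\<close>).  For \<open>u \<noteq> 0\<close> the sum over the whole space vanishes, so the sum over
  \<open>D\<close> is the negative of the sum over the set of saturated ideals below \<open>I\<close>.  That set splits
  into the space \<open>F3\<^sup>m \<times> 0\<close> and the shifted punctured box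
  \<open>{2}\<^sup>m \<times> (box vB - {0})\<close> (\<open>ideals_in_hier\<close>).

  Everything therefore rests on the sum of \<open>phi (s + w \<bullet> y)\<close> over \<open>y \<in> box vB\<close>, evaluated in
  \<open>box_phi_sum\<close>.  A box is a product of intervals, so the character sum factors over the
  coordinates.  A coordinate with \<open>vB\<^sub>i = 2\<close> contributes 3 or 0.  A coordinate with \<open>vB\<^sub>i = 1\<close>
  contributes \<open>1 + \<zeta>\<^sup>x\<close> where \<open>x = w\<^sub>i\<close>, which is 2 for \<open>x = 0\<close> and \<open>- \<zeta>\<^sup>-\<^sup>x\<close> otherwise.
  The exponents add up to the shift by \<open>- s1 vB w\<close>.  In the proofs \<open>phi\<close> replaces the complex
  characters: it is not multiplicative, but it satisfies the same one-coordinate identities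
  (\<open>phi_interval_sum\<close>), which is what an induction on the number of coordinates needs.
  Since \<open>F3\<^sup>k\<close> is itself the box of the all-twos vector, the same lemma gives the character sum
  over a full space and, for \<open>w = 0\<close>, the number of points of a box.

  The class sizes are counted by the same induction on coordinates: the choices of \<open>v\<close> and
  \<open>w\<close> are independent, and the recurrences for binomial coefficients and for \<open>N\<close> match the
  effect of one more coordinate (\<open>card_wclass\<close>).
\<close>


section \<open>Vectors over the field with three elements\<close>

lemma F3_intervals: "{0..0 :: F3} = {0}" "{0..1 :: F3} = {0, 1}" "{0..2 :: F3} = {0, 1, 2}"
proof -
  have "x \<in> {0..0} \<longleftrightarrow> x \<in> {0}" "x \<in> {0..1} \<longleftrightarrow> x \<in> {0, 1}" "x \<in> {0..2} \<longleftrightarrow> x \<in> {0, 1, 2}" for x :: F3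
    using F3_cases[of x] F3_order order.strict_trans[OF F3_order]
    by (auto simp: not_le[symmetric])
  then show "{0..0 :: F3} = {0}" "{0..1 :: F3} = {0, 1}" "{0..2 :: F3} = {0, 1, 2}"
    by blast+
qed

lemma F3_bounds: "(0 :: F3) \<le> x" "x \<le> (2 :: F3)"
proof -
  have "x \<in> {0..2}"
    unfolding F3_intervals using F3_cases[of x] by blast
  then show "0 \<le> x" "x \<le> 2"
    by simp_all
qed

lemma finite_carrier_F3: "finite (carrier_vec k :: F3 vec set)"
proof (induction k)
  case 0
  have "carrier_vec 0 = {vNil :: F3 vec}"
    by auto
  then show ?case
    by simp
next
  case (Suc k)
  have "carrier_vec (Suc k) \<subseteq> (\<lambda>(a, y). vCons a y) ` (UNIV \<times> (carrier_vec k :: F3 vec set))"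
  proof
    fix x :: "F3 vec" assume "x \<in> carrier_vec (Suc k)"
    then show "x \<in> (\<lambda>(a, y). vCons a y) ` (UNIV \<times> (carrier_vec k :: F3 vec set))"
      by (cases x) (auto simp: image_iff)
  qed
  then show ?case
    by (rule finite_subset) (auto intro!: finite_imageI finite_cartesian_product Suc simp: UNIV_F3)
qed

lemma card_carrier_vec_Suc:
  "card {w \<in> carrier_vec (Suc k). P w} =
     card {w \<in> carrier_vec k. P (vCons (0 :: F3) w)} + card {w \<in> carrier_vec k. P (vCons 1 w)}
     + card {w \<in> carrier_vec k. P (vCons 2 w)}"
proof -
  let ?S = "\<lambda>a :: F3. {w \<in> carrier_vec k. P (vCons a w)}"
  have "{w \<in> carrier_vec (Suc k). P w} = (\<lambda>(a, w). vCons a w) ` (SIGMA a:UNIV. ?S a)"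
  proof (intro equalityI subsetI)
    fix w assume "w \<in> {w \<in> carrier_vec (Suc k). P w}"
    then show "w \<in> (\<lambda>(a, w). vCons a w) ` (SIGMA a:UNIV. ?S a)"
      by (cases w) (auto simp: image_iff)
  qed auto
  also have "card \<dots> = card (SIGMA a:UNIV. ?S a)"
    by (rule card_image) (auto simp: inj_on_def)
  also have "\<dots> = (\<Sum>a\<in>UNIV. card (?S a))"
    using finite_carrier_F3 by (intro card_SigmaI) (auto simp: UNIV_F3)
  also have "\<dots> = card (?S 0) + (card (?S 1) + card (?S 2))"
    unfolding UNIV_F3 by simp
  finally show ?thesis
    by (simp only: add.assoc)
qed

text \<open>
  All statistics attached to \<open>vB\<close> and \<open>w\<close> are additive (\<open>eind\<close> is multiplicative) in the
  coordinates.  The following lemmas record the effect of a new first coordinate.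
\<close>

lemma Tset_vCons: "Tset (vCons b v) j = (if b = j then {0} else {}) \<union> Suc ` Tset v j"
  unfolding Tset_def by (auto simp: less_Suc_eq_0_disj)

lemma finite_Tset: "finite (Tset v j)"
  unfolding Tset_def by simp

lemma card_Tset_vCons: "card (Tset (vCons b v) j) = of_bool (b = j) + card (Tset v j)"
  by (simp add: Tset_vCons card_image finite_Tset)

lemma zcount_vCons:
  "zcount (vCons b v) (vCons x w) = of_bool (b = 1 \<and> x = 0) + zcount v w"
proof -
  have "{i \<in> Tset (vCons b v) 1. vCons x w $ i = 0} =
      (if b = 1 \<and> x = 0 then {0} else {}) \<union> Suc ` {i \<in> Tset v 1. w $ i = 0}"
    by (auto simp: Tset_vCons)
  then show ?thesis
    unfolding zcount_def by (simp add: card_image finite_Tset)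
qed

lemma zcount_le: "zcount v w \<le> card (Tset v 1)"
  unfolding zcount_def by (rule card_mono) (auto simp: finite_Tset)

lemma ocount_vCons:
  "ocount (vCons b v) (vCons x w) = of_bool (b = 1 \<and> x \<noteq> 0) + ocount v w"
  using zcount_le[of v w] unfolding ocount_def by (auto simp: zcount_vCons card_Tset_vCons)

lemma s1_vCons: "s1 (vCons b v) (vCons x w) = (if b = 1 then x else 0) + s1 v w"
  unfolding s1_def by (simp add: Tset_vCons finite_Tset sum.reindex)

lemma eind_vCons: "eind (vCons b v) (vCons x w) = (if b = 2 \<and> x \<noteq> 0 then 0 else eind v w)"
  unfolding eind_def by (auto simp: Tset_vCons)

lemmas vCons_stats = card_Tset_vCons zcount_vCons ocount_vCons s1_vCons eind_vCons

lemma stats_vNil: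
  "Tset vNil j = {}" "zcount vNil w = 0" "ocount vNil w = 0" "s1 vNil w = 0" "eind vNil w = 1"
  by (simp_all add: Tset_def zcount_def ocount_def s1_def eind_def)

lemma sum_card_Tset: "card (Tset v 0) + card (Tset v 1) + card (Tset v 2) = dim_vec v"
proof (induction v)
  case (vCons b v)
  then show ?case
    using F3_cases[of b] by (auto simp: card_Tset_vCons)
qed (simp add: stats_vNil)


section \<open>Character sums over boxes\<close>

lemma phi_minus: "phi (- c) = phi c"
  by (simp add: phi_def)

text \<open>
  The contribution of one coordinate.  In terms of cube roots of unity the case \<open>b = 1\<close> with
  \<open>x \<noteq> 0\<close> is \<open>1 + \<zeta>\<^sup>x = - \<zeta>\<^sup>-\<^sup>x\<close>.
\<close>

lemma phi_interval_sum:
  "(\<Sum>a\<in>{0..b}. phi (s + x * a)) =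
     (if b = 2 then 3 * of_bool (x = 0) else if b = 1 then (if x = 0 then 2 else - 1) else 1)
     * phi (s - (if b = 1 then x else 0))"
proof -
  have one: "phi s + phi (s + x) = - phi (s - x)" if "x \<noteq> 0"
    using that F3_cases[of x] F3_cases[of s] by (elim disjE; hypsubst; simp add: phi_def)
  have two: "phi s + phi (s + x) + phi (s + x * 2) = 0" if "x \<noteq> 0"
    using that F3_cases[of x] F3_cases[of s] by (elim disjE; hypsubst; simp add: phi_def)
  consider "b = 0" | "b = 1" | "b = 2" using F3_cases by blast
  then show ?thesis
  proof cases
    case 1
    then show ?thesis by (simp add: F3_intervals)
  next
    case 2
    then show ?thesis using one by (cases "x = 0") (simp_all add: F3_intervals)
  next
    case 3
    then show ?thesis using two by (cases "x = 0") (simp_all add: F3_intervals add.assoc)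
  qed
qed

lemma box_vCons: "box (vCons b v) = (\<lambda>(a, y). vCons a y) ` ({0..b} \<times> box v)"
proof (intro equalityI subsetI)
  fix x assume x: "x \<in> box (vCons b v)"
  then have carrier: "x \<in> carrier_vec (Suc (dim_vec v))"
    and le: "\<forall>i<Suc (dim_vec v). x $ i \<in> {0..vCons b v $ i}"
    unfolding box_def dim_vec_vCons by blast+
  from carrier obtain a y where xy: "x = vCons a y" and y: "y \<in> carrier_vec (dim_vec v)"
    by (cases x) auto
  have "a \<in> {0..b}"
    using le[rule_format, of 0] xy by simp
  moreover have "y \<in> box v"
    unfolding box_def using y le[rule_format, of "Suc i" for i] xy by simp
  ultimately show "x \<in> (\<lambda>(a, y). vCons a y) ` ({0..b} \<times> box v)"
    using xy by (intro image_eqI[of _ _ "(a, y)"]) simp_all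
next
  fix x assume "x \<in> (\<lambda>(a, y). vCons a y) ` ({0..b} \<times> box v)"
  then show "x \<in> box (vCons b v)"
    by (auto simp: box_def less_Suc_eq_0_disj)
qed

lemma finite_box: "finite (box v)"
  unfolding box_def by (rule finite_subset[OF Collect_restrict finite_carrier_F3])

lemma box_phi_sum:
  assumes "w \<in> carrier_vec (dim_vec vB)"
  shows "(\<Sum>y\<in>box vB. phi (s + w \<bullet> y)) =
    3 ^ card (Tset vB 2) * int (eind vB w) * 2 ^ zcount vB w * (- 1) ^ ocount vB w
      * phi (s - s1 vB w)"
  using assms
proof (induction vB arbitrary: w s)
  case vNil
  then have "box vNil = {vNil}" and "w = vNil"
    by (auto simp: box_def)
  then show ?case
    by (simp add: stats_vNil scalar_prod_def)
next
  case (vCons b v)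
  from vCons.prems obtain x w' where w: "w = vCons x w'" and w': "w' \<in> carrier_vec (dim_vec v)"
    by (cases w) auto
  let ?K = "3 ^ card (Tset v 2) * int (eind v w') * 2 ^ zcount v w' * (- 1) ^ ocount v w'"
  have "(\<Sum>y\<in>box (vCons b v). phi (s + w \<bullet> y)) =
      (\<Sum>(a, y)\<in>{0..b} \<times> box v. phi ((s + x * a) + w' \<bullet> y))"
    unfolding box_vCons by (subst sum.reindex) (auto simp: inj_on_def w add_ac intro!: sum.cong)
  also have "\<dots> = (\<Sum>a\<in>{0..b}. \<Sum>y\<in>box v. phi ((s + x * a) + w' \<bullet> y))"
    by (rule sum.cartesian_product[symmetric])
  also have "\<dots> = (\<Sum>a\<in>{0..b}. ?K * phi ((s - s1 v w') + x * a))"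
    unfolding vCons.IH[OF w'] by (simp add: diff_add_eq)
  also have "\<dots> = ?K * (\<Sum>a\<in>{0..b}. phi ((s - s1 v w') + x * a))"
    by (rule sum_distrib_left[symmetric])
  finally show ?case
    unfolding phi_interval_sum w using F3_cases[of b] by (auto simp: vCons_stats algebra_simps)
qed

text \<open>The character sum at \<open>w = 0\<close> is \<open>phi 0 = 2\<close> times the number of points.\<close>

lemma card_box: "card (box vB) = 2 ^ card (Tset vB 1) * 3 ^ card (Tset vB 2)"
proof -
  have index: "0\<^sub>v (dim_vec vB) $ i = (0 :: F3)" if "i \<in> Tset vB j" for i j
    using that by (simp add: Tset_def)
  have "{i \<in> Tset vB 1. 0\<^sub>v (dim_vec vB) $ i = (0 :: F3)} = Tset vB 1"
    using index by blast
  then have "zcount vB (0\<^sub>v (dim_vec vB)) = card (Tset vB 1)"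
    unfolding zcount_def by simp
  moreover have "eind vB (0\<^sub>v (dim_vec vB)) = 1"
    unfolding eind_def using index by simp
  moreover have "s1 vB (0\<^sub>v (dim_vec vB)) = 0"
    unfolding s1_def using index by simp
  moreover have "(\<Sum>y\<in>box vB. phi (0 + 0\<^sub>v (dim_vec vB) \<bullet> y)) = 2 * int (card (box vB))"
    by (simp add: box_def phi_def)
  ultimately have "2 * int (card (box vB)) = 2 * int (2 ^ card (Tset vB 1) * 3 ^ card (Tset vB 2))"
    using box_phi_sum[of "0\<^sub>v (dim_vec vB)" vB 0] by (simp add: ocount_def phi_def)
  then show ?thesis
    by linarith
qed

lemma box_twos: "box (twos k) = carrier_vec k"
  unfolding box_def twos_def by (auto simp: F3_bounds)

lemma Tset_twos: "Tset (twos k) 1 = {}" "Tset (twos k) 2 = {..<k}"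
  unfolding Tset_def twos_def by auto

lemma card_carrier_F3: "card (carrier_vec k :: F3 vec set) = 3 ^ k"
  using card_box[of "twos k"] by (simp add: box_twos Tset_twos)

lemma carrier_phi_sum:
  assumes "u \<in> carrier_vec k"
  shows "(\<Sum>x\<in>carrier_vec k. phi (u \<bullet> x)) = 2 * 3 ^ k * of_bool (u = 0\<^sub>v k)"
proof -
  have "eind (twos k) u = of_bool (u = 0\<^sub>v k)"
    using assms by (auto simp: eind_def Tset_twos)
  moreover have "zcount (twos k) u = 0" "ocount (twos k) u = 0" "s1 (twos k) u = 0"
    by (simp_all add: zcount_def ocount_def s1_def Tset_twos)
  moreover have "u \<in> carrier_vec (dim_vec (twos k))"
    using assms by (simp add: twos_def)
  ultimately show ?thesis
    using box_phi_sum[of u "twos k" 0] by (simp add: box_twos Tset_twos phi_def)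
qed

lemma hamming_wt_phi_sum:
  assumes "finite D"
  shows "3 * int (hamming_wt D (codeword D u)) = 2 * int (card D) - (\<Sum>x\<in>D. phi (u \<bullet> x))"
proof -
  have "int (hamming_wt D (codeword D u)) = (\<Sum>x\<in>D. of_bool (u \<bullet> x \<noteq> 0))"
    unfolding hamming_wt_def codeword_def
    using assms by (auto simp: sum_of_bool_eq intro!: arg_cong[where f = card])
  then have "3 * int (hamming_wt D (codeword D u)) = (\<Sum>x\<in>D. 3 * of_bool (u \<bullet> x \<noteq> 0))"
    by (simp only: sum_distrib_left)
  also have "\<dots> = (\<Sum>x\<in>D. 2 - phi (u \<bullet> x))"
    by (rule sum.cong) (auto simp: phi_def)
  finally show ?thesis
    by (simp add: sum_subtractf)
qed


section \<open>The saturated ideals below a given one\<close>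

lemma append_vec_inj:
  assumes "v @\<^sub>v w = v' @\<^sub>v w'" "v \<in> carrier_vec k" "v' \<in> carrier_vec k"
  shows "v = v' \<and> w = w'"
  using assms append_vec_eq[of v k v' w w'] by blast

text \<open>
  A saturated ideal whose support meets the upper level \<open>{m..<n}\<close> must have multiplicity 2
  everywhere on the lower level.  The others are supported on the lower level, where the
  relation imposes no condition at all.
\<close>

lemma ideals_in_hier:
  assumes "vB \<in> carrier_vec (n - m)" and "m \<le> n"
  shows "ideals_in (hier m n) n (twos m @\<^sub>v vB) =
    {v @\<^sub>v 0\<^sub>v (n - m) | v. v \<in> carrier_vec m} \<union>
    {twos m @\<^sub>v y | y. y \<in> box vB - {0\<^sub>v (n - m)}}" (is "?L = ?A \<union> ?B")
proof (intro equalityI subsetI)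
  fix J assume J: "J \<in> ?L"
  then have "J \<in> carrier_vec (m + (n - m))"
    using assms by (simp add: ideals_in_def saturated_ideal_def)
  then obtain v y where vy: "J = v @\<^sub>v y" "v \<in> carrier_vec m" "y \<in> carrier_vec (n - m)"
    by (metis vec_first_last_append vec_first_carrier vec_last_carrier)
  have index: "J $ (m + i) = y $ i" if "i < n - m" for i
    using vy that by simp
  show "J \<in> ?A \<union> ?B"
  proof (cases "y = 0\<^sub>v (n - m)")
    case True
    then show ?thesis using vy by blast
  next
    case False
    then obtain j where j: "j < n - m" "y $ j \<noteq> 0"
      using vy(3) by (metis carrier_vecD eq_vecI index_zero_vec)
    then have "m + j \<in> supp J"
      using index[of j] vy by (simp add: supp_def)
    then have "J $ i = 2" if "i < m" for i
      using J j that by (auto simp: ideals_in_def saturated_ideal_def hier_def)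
    then have "v = twos m"
      using vy by (intro eq_vecI) (auto simp: twos_def)
    moreover have "y $ i \<le> vB $ i" if "i < n - m" for i
    proof -
      have "J \<le> twos m @\<^sub>v vB" and dim: "dim_vec (twos m) = m" "dim_vec vB = n - m"
        using J assms by (auto simp: ideals_in_def twos_def)
      moreover from dim have "m + i < dim_vec (twos m @\<^sub>v vB)"
        using that by simp
      ultimately have "J $ (m + i) \<le> (twos m @\<^sub>v vB) $ (m + i)"
        unfolding less_eq_vec_def by blast
      then show ?thesis
        using index[OF that] that dim by simp
    qed
    then have "y \<in> box vB"
      using assms vy by (auto simp: box_def F3_bounds)
    ultimately show ?thesis
      using vy False by blast
  qed
next
  fix J assume "J \<in> ?A \<union> ?B"
  then show "J \<in> ?L"
  proof
    assume "J \<in> ?A"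
    then obtain v where "J = v @\<^sub>v 0\<^sub>v (n - m)" "v \<in> carrier_vec m" by blast
    then show ?thesis
      using assms
      by (auto simp: ideals_in_def saturated_ideal_def down_closed_def supp_def hier_def
          less_eq_vec_def twos_def F3_bounds intro!: carrier_vecI)
  next
    assume "J \<in> ?B"
    then obtain y where "J = twos m @\<^sub>v y" "y \<in> box vB" by blast
    then show ?thesis
      using assms
      by (auto simp: ideals_in_def saturated_ideal_def down_closed_def supp_def hier_def
          less_eq_vec_def twos_def F3_bounds box_def intro!: carrier_vecI)
  qed
qed

text \<open>
  The vector \<open>twos m @\<^sub>v 0\<close> lies in the first part of the union in \<open>ideals_in_hier\<close>.  It is included in
  the sum over the full box and then subtracted, which keeps the box sum in product form.
\<close>

lemma sum_ideals_in_hier: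
  fixes f :: "F3 vec \<Rightarrow> int"
  assumes "vB \<in> carrier_vec (n - m)" and "m \<le> n"
  shows "sum f (ideals_in (hier m n) n (twos m @\<^sub>v vB)) =
    (\<Sum>v\<in>carrier_vec m. f (v @\<^sub>v 0\<^sub>v (n - m))) + (\<Sum>y\<in>box vB. f (twos m @\<^sub>v y))
      - f (twos m @\<^sub>v 0\<^sub>v (n - m))"
proof -
  let ?A = "(\<lambda>v. v @\<^sub>v 0\<^sub>v (n - m)) ` carrier_vec m :: F3 vec set"
  let ?B = "(\<lambda>y. twos m @\<^sub>v y) ` (box vB - {0\<^sub>v (n - m)})"
  have twos: "twos m \<in> carrier_vec m"
    by (simp add: twos_def)
  have zero: "0\<^sub>v (n - m) \<in> box vB"
    using assms by (simp add: box_def F3_bounds)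
  have "ideals_in (hier m n) n (twos m @\<^sub>v vB) = ?A \<union> ?B"
    unfolding ideals_in_hier[OF assms] by blast
  moreover have "?A \<inter> ?B = {}"
    using append_vec_inj[OF _ _ twos] by blast
  ultimately have "sum f (ideals_in (hier m n) n (twos m @\<^sub>v vB)) = sum f ?A + sum f ?B"
    by (simp add: sum.union_disjoint finite_carrier_F3 finite_box)
  also have "sum f ?A = (\<Sum>v\<in>carrier_vec m. f (v @\<^sub>v 0\<^sub>v (n - m)))"
    by (subst sum.reindex) (auto intro!: inj_onI dest: append_vec_inj)
  also have "sum f ?B = (\<Sum>y\<in>box vB - {0\<^sub>v (n - m)}. f (twos m @\<^sub>v y))"
    by (subst sum.reindex) (auto intro!: inj_onI dest: append_vec_inj[OF _ twos twos])
  also have "\<dots> = (\<Sum>y\<in>box vB. f (twos m @\<^sub>v y)) - f (twos m @\<^sub>v 0\<^sub>v (n - m))"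
    using zero by (simp add: sum_diff1 finite_box)
  finally show ?thesis by simp
qed

lemma scalar_prod_twos: "v \<in> carrier_vec k \<Longrightarrow> v \<bullet> twos k = 2 * coord_sum v"
  unfolding scalar_prod_def coord_sum_def sum_distrib_left
  by (rule sum.cong) (auto simp: twos_def mult.commute)

lemma hamming_wt_codeword:
  assumes vB: "vB \<in> carrier_vec (n - m)" and mn: "m \<le> n"
    and D: "D = carrier_vec n - ideals_in (hier m n) n (twos m @\<^sub>v vB)"
    and v: "v \<in> carrier_vec m" and w: "w \<in> carrier_vec (n - m)" and nz: "v @\<^sub>v w \<noteq> 0\<^sub>v n"
  shows "3 * int (hamming_wt D (codeword D (v @\<^sub>v w))) =
    2 * int (card D) + 2 * 3 ^ m * of_bool (v = 0\<^sub>v m)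
    + 3 ^ card (Tset vB 2) * int (eind vB w) * 2 ^ zcount vB w * (- 1) ^ ocount vB w
        * phi (coord_sum v + s1 vB w)
    - phi (coord_sum v)"
proof -
  let ?u = "v @\<^sub>v w" and ?J = "ideals_in (hier m n) n (twos m @\<^sub>v vB)"
  have u: "?u \<in> carrier_vec n"
    using v w mn by (metis append_carrier_vec le_add_diff_inverse)
  have J: "?J \<subseteq> carrier_vec n"
    by (auto simp: ideals_in_def saturated_ideal_def)
  have twos: "twos m \<in> carrier_vec m"
    by (simp add: twos_def)
  \<comment> \<open>The pairing with \<open>twos m\<close> yields \<open>2 * coord_sum v = - coord_sum v\<close>; evenness of \<open>phi\<close>
    then removes the sign.\<close>
  have double: "2 * c = - c" for c :: F3
    using F3_cases[of c] by auto
  have prod: "?u \<bullet> (x @\<^sub>v y) = v \<bullet> x + w \<bullet> y"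
    if "x \<in> carrier_vec m" "y \<in> carrier_vec (n - m)" for x y
    using scalar_prod_append[OF v w that] .
  have "(\<Sum>x\<in>?J. phi (?u \<bullet> x)) =
      (\<Sum>x\<in>carrier_vec m. phi (v \<bullet> x)) + (\<Sum>y\<in>box vB. phi (2 * coord_sum v + w \<bullet> y))
      - phi (2 * coord_sum v)"
  proof -
    have "phi (?u \<bullet> (x @\<^sub>v 0\<^sub>v (n - m))) = phi (v \<bullet> x)" if "x \<in> carrier_vec m" for x
      using that w by (simp add: prod)
    moreover have "phi (?u \<bullet> (twos m @\<^sub>v y)) = phi (2 * coord_sum v + w \<bullet> y)"
      if "y \<in> carrier_vec (n - m)" for y
      using that twos v by (simp add: prod scalar_prod_twos)
    moreover have "y \<in> carrier_vec (n - m)" if "y \<in> box vB" for y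
      using that vB by (simp add: box_def)
    ultimately show ?thesis
      unfolding sum_ideals_in_hier[OF vB mn] using w by simp
  qed
  also have "\<dots> = 2 * 3 ^ m * of_bool (v = 0\<^sub>v m)
      + 3 ^ card (Tset vB 2) * int (eind vB w) * 2 ^ zcount vB w * (- 1) ^ ocount vB w
          * phi (2 * coord_sum v - s1 vB w)
      - phi (2 * coord_sum v)"
    using carrier_phi_sum[OF v] box_phi_sum[of w vB "2 * coord_sum v"] w vB by simp
  also have "phi (2 * coord_sum v - s1 vB w) = phi (coord_sum v + s1 vB w)"
    unfolding double using phi_minus[of "coord_sum v + s1 vB w"] by simp
  also have "phi (2 * coord_sum v) = phi (coord_sum v)"
    unfolding double by (rule phi_minus)
  finally have "(\<Sum>x\<in>?J. phi (?u \<bullet> x)) = 2 * 3 ^ m * of_bool (v = 0\<^sub>v m)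
      + 3 ^ card (Tset vB 2) * int (eind vB w) * 2 ^ zcount vB w * (- 1) ^ ocount vB w
          * phi (coord_sum v + s1 vB w)
      - phi (coord_sum v)" .
  moreover have "(\<Sum>x\<in>D. phi (?u \<bullet> x)) = - (\<Sum>x\<in>?J. phi (?u \<bullet> x))"
    unfolding D sum_diff[OF finite_carrier_F3 J] carrier_phi_sum[OF u] using nz by simp
  moreover have "finite D"
    unfolding D using finite_carrier_F3 by blast
  ultimately show ?thesis
    using hamming_wt_phi_sum[of D ?u] by simp
qed

lemma card_complement_ideals:
  assumes vB: "vB \<in> carrier_vec (n - m)" and mn: "m \<le> n"
  shows "int (card (carrier_vec n - ideals_in (hier m n) n (twos m @\<^sub>v vB))) =
    3 ^ n - 3 ^ m - 2 ^ card (Tset vB 1) * 3 ^ card (Tset vB 2) + 1"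
proof -
  let ?J = "ideals_in (hier m n) n (twos m @\<^sub>v vB)"
  have J: "?J \<subseteq> carrier_vec n"
    by (auto simp: ideals_in_def saturated_ideal_def)
  have "int (card ?J) = 3 ^ m + 2 ^ card (Tset vB 1) * 3 ^ card (Tset vB 2) - 1"
    using sum_ideals_in_hier[OF assms, of "\<lambda>_. 1"] by (simp add: card_carrier_F3 card_box)
  moreover have "int (card (carrier_vec n - ?J)) = 3 ^ n - int (card ?J)"
    using sum_diff[OF finite_carrier_F3 J, of "\<lambda>_. 1 :: int"] by (simp add: card_carrier_F3)
  ultimately show ?thesis
    by simp
qed


section \<open>Sizes of the classes\<close>

text \<open>The set of all \<open>w\<close> meeting the conditions that \<open>uclass\<close> places on the upper part.\<close>

definition wclass :: "F3 vec \<Rightarrow> nat \<Rightarrow> nat \<Rightarrow> F3 \<Rightarrow> F3 vec set" where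
  "wclass vB e z c =
     {w \<in> carrier_vec (dim_vec vB). eind vB w = e \<and> zcount vB w = z \<and> s1 vB w = c}"

text \<open>
  The coordinates in \<open>Tset vB 0\<close> are free, those in \<open>Tset vB 2\<close> are all zero or not all zero
  according to \<open>e\<close>, and on \<open>Tset vB 1\<close> one chooses the \<open>z\<close> zero positions and nonzero entries
  with sum \<open>c\<close> on the rest.
\<close>

lemma card_wclass:
  assumes "e \<in> {0, 1}"
  shows "int (card (wclass vB e z c)) =
    (of_bool (e = 1) + (3 ^ card (Tset vB 2) - 1) * of_bool (e = 0))
      * int (card (Tset vB 1) choose z) * int (N c (card (Tset vB 1) - z)) * 3 ^ card (Tset vB 0)"
  using assms
proof (induction vB arbitrary: e z c)
  case vNil
  have "N c 0 = of_bool (c = 0)"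
    using N_closed_form[of c 0] by auto
  moreover have "wclass vNil e z c = (if e = 1 \<and> z = 0 \<and> c = 0 then {vNil} else {})"
    by (auto simp: wclass_def stats_vNil)
  ultimately show ?case
    using vNil by (cases z) (auto simp: stats_vNil)
next
  case (vCons b v)
  let ?X = "\<lambda>x. {w \<in> carrier_vec (dim_vec v). eind (vCons b v) (vCons x w) = e
      \<and> zcount (vCons b v) (vCons x w) = z \<and> s1 (vCons b v) (vCons x w) = c}"
  have split: "card (wclass (vCons b v) e z c) = card (?X 0) + card (?X 1) + card (?X 2)"
    unfolding wclass_def dim_vec_vCons by (rule card_carrier_vec_Suc)
  consider "b = 0" | "b = 1" | "b = 2" using F3_cases by blast
  then show ?case
  proof cases
    case 1
    then have "?X x = wclass v e z c" for x
      by (auto simp: wclass_def vCons_stats)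
    then show ?thesis
      unfolding split using 1 vCons.IH[OF vCons.prems] by (simp add: vCons_stats)
  next
    case 2
    have "?X 0 = (case z of 0 \<Rightarrow> {} | Suc z' \<Rightarrow> wclass v e z' c)"
      using 2 by (auto simp: wclass_def vCons_stats split: nat.splits)
    moreover have "?X 1 = wclass v e z (c - 1)" "?X 2 = wclass v e z (c - 2)"
      using 2 by (auto simp: wclass_def vCons_stats)
    ultimately have eq: "card (wclass (vCons b v) e z c) =
        (case z of 0 \<Rightarrow> 0 | Suc z' \<Rightarrow> card (wclass v e z' c))
        + card (wclass v e z (c - 1)) + card (wclass v e z (c - 2))"
      unfolding split by (simp split: nat.splits)
    let ?t = "card (Tset v 1)"
    \<comment> \<open>Pascal's rule combined with the recurrence for \<open>N\<close>: the new entry is either one of the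
      \<open>z\<close> zeros or one of the two nonzero values.\<close>
    have choose: "int (Suc ?t choose z) * int (N c (Suc ?t - z)) =
        (case z of 0 \<Rightarrow> 0 | Suc z' \<Rightarrow> int (?t choose z') * int (N c (?t - z')))
        + int (?t choose z) * int (N (c - 1) (?t - z))
        + int (?t choose z) * int (N (c - 2) (?t - z))"
    proof (cases "z \<le> ?t")
      case True
      then show ?thesis
        by (cases z) (simp_all add: N_Suc Suc_diff_le Suc_diff_Suc[symmetric] algebra_simps)
    next
      case False
      then show ?thesis
        by (cases z) (simp_all add: binomial_eq_0)
    qed
    define A :: int where
      "A = of_bool (e = 1) + (3 ^ card (Tset v 2) - 1) * of_bool (e = 0)"
    have IH: "int (card (wclass v e z' c')) =
        A * int (?t choose z') * int (N c' (?t - z')) * 3 ^ card (Tset v 0)" for z' c'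
      unfolding A_def by (rule vCons.IH[OF vCons.prems])
    have "int (card (wclass (vCons b v) e z c)) =
        A * (int (Suc ?t choose z) * int (N c (Suc ?t - z))) * 3 ^ card (Tset v 0)"
      unfolding eq choose by (cases z) (simp_all add: IH algebra_simps)
    then show ?thesis
      using 2 by (simp add: A_def vCons_stats mult.assoc)
  next
    case 3
    have zero: "?X 0 = wclass v e z c"
      using 3 by (auto simp: wclass_def vCons_stats)
    have nonzero: "?X x = (if e = 0 then wclass v 0 z c \<union> wclass v 1 z c else {})" if "x \<noteq> 0" for x
    proof -
      have "eind v w = 0 \<or> eind v w = 1" for w
        by (simp add: eind_def)
      then show ?thesis
        using 3 that vCons.prems by (auto simp: wclass_def vCons_stats)
    qed
    have fin: "finite (wclass v e' z c)" for e'
      unfolding wclass_def by (rule finite_subset[OF Collect_restrict finite_carrier_F3])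
    have "wclass v 0 z c \<inter> wclass v 1 z c = {}"
      by (auto simp: wclass_def)
    then have union: "card (wclass v 0 z c \<union> wclass v 1 z c) =
        card (wclass v 0 z c) + card (wclass v 1 z c)"
      by (simp add: card_Un_disjoint fin)
    have "card (?X x) = (if e = 0 then card (wclass v 0 z c) + card (wclass v 1 z c) else 0)"
      if "x \<noteq> 0" for x
      unfolding nonzero[OF that] using union by simp
    from this[of 1] this[of 2] have eq: "card (wclass (vCons b v) e z c) = card (wclass v e z c)
        + 2 * (if e = 0 then card (wclass v 0 z c) + card (wclass v 1 z c) else 0)"
      unfolding split zero by simp
    show ?thesis
      unfolding eq using 3 vCons.prems vCons.IH[of 0 z c] vCons.IH[of 1 z c]
      by (auto simp: vCons_stats algebra_simps)
  qed
qed

lemma card_uclass: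
  assumes vB: "vB \<in> carrier_vec (n - m)" and mn: "m \<le> n" and e: "e \<in> {0, 1}"
  shows "int (card (uclass m vB b \<sigma> e z c - {0\<^sub>v n})) =
    int (card (vclass m b \<sigma>)) *
      ((of_bool (e = 1) + (3 ^ card (Tset vB 2) - 1) * of_bool (e = 0))
        * int (card (Tset vB 1) choose z) * int (N c (card (Tset vB 1) - z))
        * 3 ^ (n - m - card (Tset vB 1) - card (Tset vB 2)))
    - of_bool (0\<^sub>v n \<in> uclass m vB b \<sigma> e z c)"
proof -
  have image: "uclass m vB b \<sigma> e z c = (\<lambda>(v, w). v @\<^sub>v w) ` (vclass m b \<sigma> \<times> wclass vB e z c)"
    unfolding uclass_def wclass_def by auto
  have "inj_on (\<lambda>(v, w). v @\<^sub>v w) (vclass m b \<sigma> \<times> wclass vB e z c)"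
    by (auto simp: vclass_def intro!: inj_onI dest: append_vec_inj)
  then have card: "card (uclass m vB b \<sigma> e z c) = card (vclass m b \<sigma>) * card (wclass vB e z c)"
    unfolding image by (simp add: card_image card_cartesian_product)
  have "finite (vclass m b \<sigma>)" "finite (wclass vB e z c)"
    unfolding vclass_def wclass_def by (rule finite_subset[OF Collect_restrict finite_carrier_F3])+
  then have fin: "finite (uclass m vB b \<sigma> e z c)"
    unfolding image by simp
  have diff: "int (card (A - {x})) = int (card A) - of_bool (x \<in> A)"
    if "finite A" for A and x :: "F3 vec"
    using sum_diff1[OF that, of "\<lambda>_. 1 :: int" x] by simp
  have "card (Tset vB 0) = n - m - card (Tset vB 1) - card (Tset vB 2)"
    using sum_card_Tset[of vB] vB by simp
  then show ?thesis
    unfolding diff[OF fin] card using card_wclass[OF e] by simp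
qed

text \<open>The first coordinate is determined by the others and the prescribed sum.\<close>

lemma card_coord_sum: "card {v \<in> carrier_vec (Suc k). coord_sum v = \<sigma>} = 3 ^ k"
proof -
  have "{v \<in> carrier_vec (Suc k). coord_sum v = \<sigma>} =
      (\<lambda>y. vCons (\<sigma> - coord_sum y) y) ` carrier_vec k"
  proof (intro equalityI subsetI)
    fix v assume "v \<in> {v \<in> carrier_vec (Suc k). coord_sum v = \<sigma>}"
    then show "v \<in> (\<lambda>y. vCons (\<sigma> - coord_sum y) y) ` carrier_vec k"
      by (cases v) (auto simp: coord_sum_vCons)
  qed (auto simp: coord_sum_vCons)
  also have "card \<dots> = 3 ^ k"
    by (subst card_image) (auto simp: inj_on_def card_carrier_F3)
  finally show ?thesis .
qed

lemma coord_sum_zero: "coord_sum (0\<^sub>v k) = 0"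
  by (simp add: coord_sum_def)

lemma card_vclass:
  assumes "1 \<le> m"
  shows "card (vclass m True 0) = 1"
    and "int (card (vclass m False 0)) = 3 ^ (m - 1) - 1"
    and "\<sigma> \<noteq> 0 \<Longrightarrow> card (vclass m False \<sigma>) = 3 ^ (m - 1)"
proof -
  let ?V = "\<lambda>\<sigma>. {v \<in> carrier_vec m. coord_sum v = \<sigma>}"
  have V: "card (?V \<sigma>) = 3 ^ (m - 1)" for \<sigma>
    using card_coord_sum[of "m - 1" \<sigma>] assms by simp
  have "vclass m True 0 = {0\<^sub>v m}"
    by (auto simp: vclass_def coord_sum_zero)
  then show "card (vclass m True 0) = 1"
    by simp
  have "vclass m False 0 = ?V 0 - {0\<^sub>v m}"
    by (auto simp: vclass_def)
  then have "card (vclass m False 0) = 3 ^ (m - 1) - 1"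
    by (simp add: V coord_sum_zero)
  then show "int (card (vclass m False 0)) = 3 ^ (m - 1) - 1"
    by (simp add: of_nat_diff)
  assume "\<sigma> \<noteq> 0"
  then have "vclass m False \<sigma> = ?V \<sigma>"
    by (auto simp: vclass_def coord_sum_zero)
  then show "card (vclass m False \<sigma>) = 3 ^ (m - 1)"
    by (simp only: V)
qed

theorem theorem6p4:
  fixes m n t1 t2 :: nat and I vB :: "F3 vec" and D :: "F3 vec set"
  assumes "1 \<le> m" and "m \<le> n - 1"
    and "saturated_ideal (hier m n) n I"
    and "vB \<in> carrier_vec (n - m)" and "vB \<noteq> 0\<^sub>v (n - m)"
    and "I = twos m @\<^sub>v vB"
    and "t1 = card (Tset vB 1)" and "t2 = card (Tset vB 2)"
    and "D = carrier_vec n - ideals_in (hier m n) n I"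
  shows
    "(ideals_in (hier m n) n I =
       {v @\<^sub>v 0\<^sub>v (n - m) | v. v \<in> carrier_vec m} \<union>
       {twos m @\<^sub>v y | y. y \<in> box vB - {0\<^sub>v (n - m)}})
     \<and> (int (card D) = 3 ^ n - 3 ^ m - 2 ^ t1 * 3 ^ t2 + 1)
     \<and> (\<forall>v\<in>carrier_vec m. \<forall>w\<in>carrier_vec (n - m). \<forall>u. \<forall>\<sigma>.
       u = v @\<^sub>v w \<longrightarrow> u \<noteq> 0\<^sub>v n \<longrightarrow> \<sigma> = coord_sum v \<longrightarrow>
       real (hamming_wt D (codeword D u)) =
         1 / 3 * (2 * real (card D) + 2 * 3 ^ m * of_bool (v = 0\<^sub>v m)
           + 3 ^ t2 * real (eind vB w) * 2 ^ zcount vB w * (- 1) ^ ocount vB w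
               * real_of_int (phi (\<sigma> + s1 vB w))
           - real_of_int (phi \<sigma>)))
     \<and> (\<forall>b. \<forall>\<sigma>. \<forall>e\<in>{0, 1}. \<forall>z. \<forall>c.
       int (card (uclass m vB b \<sigma> e z c - {0\<^sub>v n})) =
         int (card (vclass m b \<sigma>)) *
           ((of_bool (e = 1) + (3 ^ t2 - 1) * of_bool (e = 0))
             * int (t1 choose z) * int (N c (t1 - z)) * 3 ^ (n - m - t1 - t2))
         - of_bool (0\<^sub>v n \<in> uclass m vB b \<sigma> e z c))
     \<and> (card (vclass m True 0) = 1)
     \<and> (int (card (vclass m False 0)) = 3 ^ (m - 1) - 1)
     \<and> (\<forall>\<sigma>. \<sigma> \<noteq> 0 \<longrightarrow> card (vclass m False \<sigma>) = 3 ^ (m - 1))"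
proof -
  note I = assms(6) and t1 = assms(7) and t2 = assms(8)
  have mn: "m \<le> n" and vB: "vB \<in> carrier_vec (n - m)"
    using assms by simp_all
  have D: "D = carrier_vec n - ideals_in (hier m n) n (twos m @\<^sub>v vB)"
    using assms(9) I by simp
  have weight: "real (hamming_wt D (codeword D (v @\<^sub>v w))) =
      1 / 3 * (2 * real (card D) + 2 * 3 ^ m * of_bool (v = 0\<^sub>v m)
        + 3 ^ card (Tset vB 2) * real (eind vB w) * 2 ^ zcount vB w * (- 1) ^ ocount vB w
            * real_of_int (phi (coord_sum v + s1 vB w))
        - real_of_int (phi (coord_sum v)))"
    if "v \<in> carrier_vec m" "w \<in> carrier_vec (n - m)" "v @\<^sub>v w \<noteq> 0\<^sub>v n" for v w
    using arg_cong[OF hamming_wt_codeword[OF vB mn D that], of real_of_int] by simp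
  show ?thesis
    unfolding I t1 t2
  proof (intro conjI ballI allI impI, goal_cases)
    case 1
    show ?case by (rule ideals_in_hier[OF vB mn])
  next
    case 2
    show ?case unfolding D by (rule card_complement_ideals[OF vB mn])
  next
    case (3 v w u \<sigma>)
    then show ?case using weight[of v w] by simp
  next
    case (4 b \<sigma> e z c)
    show ?case by (rule card_uclass[OF vB mn 4])
  next
    case 5
    show ?case by (rule card_vclass(1)[OF assms(1)])
  next
    case 6
    show ?case by (rule card_vclass(2)[OF assms(1)])
  next
    case (7 \<sigma>)
    then show ?case by (rule card_vclass(3)[OF assms(1)])
  qed
qed

end
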